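(* Let $m,n\ge 3$ be odd, coprime integers such that $q=2mn+1$ is a prime power. Then there exists a globally simple Heffter array H$(m,n)$ over $\mathbb{F}_q$.
   Context: A half-set of an additive group $G$ of odd order $2\ell+1$ is an $\ell$-subset $L$ with $L\cup -L=G\setminus\{0\}$. A Heffter array H$(m,n)$ over $\mathbb{F}_q$ is an $m\times n$ matrix over $\mathbb{F}_q$ whose entries form a half-set of the additive group of $\mathbb{F}_q$ and whose every row and column sums to $0$. An H$(m,n)$ $A=(a_{i,j})$ is globally simple if for each row $i$ the partial sums $\sum_{k=1}^j a_{i,k}$ ($1\le j\le n$) are pairwise distinct and for each column $j$ the partial sums $\sum_{k=1}^i a_{k,j}$ ($1\le i\le m$) are pairwise distinct. *)

theory Defs
  imports "HOL-Library.Cardinality" "HOL-Number_Theory.Prime_Powers" "Jordan_Normal_Form.Matrix"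
begin

text \<open>The ambient additive group is the whole type; the first conjunct says that
  its order is \<open>2 \<ell> + 1\<close> with \<open>\<ell>\<close> the size of \<open>L\<close>.\<close>

definition half_set :: "'a :: {ab_group_add, finite} set \<Rightarrow> bool" where
  "half_set L \<longleftrightarrow> CARD('a) = 2 * card L + 1 \<and> L \<union> uminus ` L = UNIV - {0}"

text \<open>\<open>elements_mat A\<close> is a set, so repetitions are invisible to \<open>half_set\<close>. When
  \<open>CARD('a) = 2 * m * n + 1\<close> a half-set has \<open>m * n\<close> elements, which forces the \<open>m * n\<close>
  entries of \<open>A\<close> to be pairwise distinct. Rows and columns are indexed from 0.\<close>

definition heffter_array :: "nat \<Rightarrow> nat \<Rightarrow> 'a :: {field, finite} mat \<Rightarrow> bool" where
  "heffter_array m n A \<longleftrightarrow>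
     A \<in> carrier_mat m n \<and>
     half_set (elements_mat A) \<and>
     (\<forall>i<m. (\<Sum>j<n. A $$ (i, j)) = 0) \<and>
     (\<forall>j<n. (\<Sum>i<m. A $$ (i, j)) = 0)"

text \<open>The partial sums compared are those of the first \<open>j \<ge> 1\<close> (resp. \<open>i \<ge> 1\<close>) entries;
  the empty sum is not among them.\<close>

definition globally_simple :: "'a :: {field, finite} mat \<Rightarrow> bool" where
  "globally_simple A \<longleftrightarrow>
     (\<forall>i<dim_row A. inj_on (\<lambda>j. \<Sum>k<j. A $$ (i, k)) {1..dim_col A}) \<and>
     (\<forall>j<dim_col A. inj_on (\<lambda>i. \<Sum>k<i. A $$ (k, j)) {1..dim_row A})"

end

theory Submission
  imports Defs "HOL-Number_Theory.Cong" "HOL-Algebra.Multiplicative_Group"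
    "HOL-Algebra.Algebraic_Closure_Type"
begin

text \<open>The multiplicative group of the field is cyclic of order \<open>2 m n\<close>, so it contains elements
  \<open>x\<close> of order \<open>m\<close> and \<open>y\<close> of order \<open>n\<close>. Take the rank-one array with entries \<open>x\<^sup>i y\<^sup>j\<close>. By
  coprimality its entries run through the subgroup of odd order \<open>m n\<close>, which has index 2 and does not
  contain \<open>-1\<close>, hence is a half-set. The rows and columns are nonzero multiples of
  the sequences of powers of \<open>y\<close> and \<open>x\<close>, whose partial sums are geometric.\<close>

text \<open>Cyclicity of the multiplicative group, carried over from the structure
  \<open>ring_of_type_algebra\<close> to type class arithmetic. In the divisibility form the order
  of any power of \<open>g\<close> can be read off directly.\<close>

lemma finite_field_primitive_element:
  obtains g :: "'a :: {field, finite}"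
    where "\<And>k. g ^ k = 1 \<longleftrightarrow> CARD('a) - 1 dvd k"
proof -
  define R where "R = (ring_of_type_algebra :: 'a ring)"
  interpret R: field R
    unfolding R_def by (rule field_from_type_algebra)
  let ?M = "Multiplicative_Group.mult_of R"
  have fin: "finite (carrier R)" by simp
  interpret M: group ?M
    by (rule R.field_mult_group)
  have carr: "carrier R = UNIV" and one: "\<one>\<^bsub>R\<^esub> = 1"
    and mult: "\<And>a b. a \<otimes>\<^bsub>R\<^esub> b = a * b"
    by (simp_all add: R_def ring_of_type_algebra_def)
  have pow: "a [^]\<^bsub>?M\<^esub> k = a ^ k" for a and k :: nat
    by (induction k) (simp_all add: one mult mult.commute)
  obtain g where g: "g \<in> carrier ?M"
    and gen: "carrier ?M = {g [^]\<^bsub>R\<^esub> i | i :: nat. i \<in> UNIV}"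
    using R.finite_field_mult_group_has_gen[OF fin] by blast
  \<comment> \<open>The powers of \<open>g\<close> exhaust the group, and those with exponent below
    \<open>M.ord g\<close> already give each of them exactly once.\<close>
  have "Coset.order ?M = card {g [^]\<^bsub>?M\<^esub> i | i :: nat. i \<in> UNIV}"
    using gen by (simp add: Coset.order_def Multiplicative_Group.nat_pow_mult_of)
  also have "\<dots> = card ((\<lambda>i. g [^]\<^bsub>?M\<^esub> i) ` {0..M.ord g - 1})"
    using M.ord_elems[OF R.finite_mult_of[OF fin] g] by (simp only: Setcompr_eq_image)
  also have "\<dots> = M.ord g"
    using M.ord_ge_1[OF R.finite_mult_of[OF fin] g] M.ord_inj[OF g] by (simp add: card_image)
  finally have "M.ord g = Coset.order ?M" ..
  also have "\<dots> = CARD('a) - 1"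
    using R.order_mult_of[OF fin] by (simp add: Coset.order_def carr)
  finally have ord: "M.ord g = CARD('a) - 1" .
  have "g ^ k = 1 \<longleftrightarrow> CARD('a) - 1 dvd k" for k
    using M.pow_eq_id[OF g, of k] by (simp add: pow ord one)
  then show thesis by (rule that)
qed

lemma power_eq_iff_cong_of_order:
  fixes x :: "'a :: field"
  assumes ord: "\<And>k. x ^ k = 1 \<longleftrightarrow> d dvd k" and "d > 0"
  shows "x ^ a = x ^ b \<longleftrightarrow> [a = b] (mod d)"
proof -
  have "x ^ d = 1" by (simp add: ord)
  then have x: "x \<noteq> 0" using \<open>d > 0\<close> by (auto simp: power_0_left)
  have *: "x ^ a = x ^ b \<longleftrightarrow> [a = b] (mod d)" if "b \<le> a" for a b
  proof -
    have "x ^ a = x ^ b * x ^ (a - b)"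
      using that by (simp flip: power_add)
    then have "x ^ a = x ^ b \<longleftrightarrow> x ^ (a - b) = 1"
      using x by simp
    then show ?thesis
      using that by (simp add: ord cong_altdef_nat)
  qed
  show ?thesis
    using *[of a b] *[of b a] by (metis cong_sym nat_le_linear)
qed

text \<open>As \<open>d > 1\<close>, \<open>x\<close> differs from 1, and the numerator
  \<open>x ^ d - 1\<close> of the geometric sum vanishes.\<close>

lemma sum_geometric_of_order_eq_0:
  fixes c x :: "'a :: field"
  assumes "\<And>k. x ^ k = 1 \<longleftrightarrow> d dvd k" and "d > 1"
  shows "(\<Sum>k<d. c * x ^ k) = 0"
proof -
  have "x \<noteq> 1" using assms(1)[of 1] \<open>d > 1\<close> by auto
  then show ?thesis
    using assms(1)[of d] by (simp add: geometric_sum flip: sum_distrib_left)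
qed

text \<open>The sum of the first \<open>j\<close> terms is \<open>c * (x ^ j - 1) / (x - 1)\<close>,
  so it determines \<open>x ^ j\<close>, hence \<open>j\<close> modulo \<open>d\<close>; and
  \<open>{1..d}\<close> is a complete residue system.\<close>

lemma inj_on_partial_geometric_sum_of_order:
  fixes c x :: "'a :: field"
  assumes ord: "\<And>k. x ^ k = 1 \<longleftrightarrow> d dvd k" and "d > 1" and "c \<noteq> 0"
  shows "inj_on (\<lambda>j. \<Sum>k<j. c * x ^ k) {1..d}"
proof (rule inj_onI)
  fix a b assume a: "a \<in> {1..d}" and b: "b \<in> {1..d}"
    and eq: "(\<Sum>k<a. c * x ^ k) = (\<Sum>k<b. c * x ^ k)"
  have "x \<noteq> 1" using ord[of 1] \<open>d > 1\<close> by auto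
  with eq \<open>c \<noteq> 0\<close> have "x ^ a = x ^ b"
    by (simp add: geometric_sum flip: sum_distrib_left)
  \<comment> \<open>The shift moves \<open>{1..d}\<close> to residues below \<open>d\<close>, where
    congruence means equality.\<close>
  then have "[a - 1 + 1 = b - 1 + 1] (mod d)"
    using power_eq_iff_cong_of_order[OF ord, of a b] \<open>d > 1\<close> a b by simp
  then have "[a - 1 = b - 1] (mod d)"
    using cong_add_rcancel_nat by blast
  then have "a - 1 = b - 1"
    using a b by (intro cong_less_modulus_unique_nat) auto
  then show "a = b"
    using a b by (metis atLeastAtMost_iff le_add_diff_inverse2)
qed

text \<open>The \<open>n\<close>-th power kills the factor in \<open>y\<close>, and \<open>n\<close>
  is invertible modulo \<open>m\<close>, so \<open>i\<close> is recovered; the \<open>m\<close>-th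
  power recovers \<open>j\<close> in the same way.\<close>

lemma inj_on_mult_powers_of_coprime_order:
  fixes x y :: "'a :: field"
  assumes ord_x: "\<And>k. x ^ k = 1 \<longleftrightarrow> m dvd k" and ord_y: "\<And>k. y ^ k = 1 \<longleftrightarrow> n dvd k"
    and "m > 0" and "n > 0" and "coprime m n"
  shows "inj_on (\<lambda>(i, j). x ^ i * y ^ j) ({..<m} \<times> {..<n})"
proof (rule inj_onI, clarsimp)
  fix i j k l
  assume lt: "i < m" "j < n" "k < m" "l < n" and eq: "x ^ i * y ^ j = x ^ k * y ^ l"
  have y1: "y ^ (e * n) = 1" and x1: "x ^ (e * m) = 1" for e
    using ord_x ord_y by simp_all
  from eq have "(x ^ i * y ^ j) ^ n = (x ^ k * y ^ l) ^ n" by simp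
  then have "x ^ (i * n) = x ^ (k * n)"
    by (simp add: power_mult_distrib y1 flip: power_mult)
  then have "[i * n = k * n] (mod m)"
    using power_eq_iff_cong_of_order[OF ord_x] \<open>m > 0\<close> by blast
  then have "[i = k] (mod m)"
    using \<open>coprime m n\<close> by (simp add: cong_mult_rcancel_nat coprime_commute)
  then have i: "i = k"
    using lt cong_less_modulus_unique_nat by blast
  from eq have "(x ^ i * y ^ j) ^ m = (x ^ k * y ^ l) ^ m" by simp
  then have "y ^ (j * m) = y ^ (l * m)"
    by (simp add: power_mult_distrib x1 flip: power_mult)
  then have "[j * m = l * m] (mod n)"
    using power_eq_iff_cong_of_order[OF ord_y] \<open>n > 0\<close> by blast
  then have "[j = l] (mod n)"
    using \<open>coprime m n\<close> by (simp add: cong_mult_rcancel_nat)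
  then have "j = l"
    using lt cong_less_modulus_unique_nat by blast
  with i show "i = k \<and> j = l" by simp
qed

text \<open>By disjointness \<open>L\<close> and its negative together have
  \<open>2 * card L\<close> elements, as many as there are nonzero elements.\<close>

lemma half_setI:
  fixes L :: "'a :: {ab_group_add, finite} set"
  assumes card: "CARD('a) = 2 * card L + 1" and "0 \<notin> L" and disj: "L \<inter> uminus ` L = {}"
  shows "half_set L"
proof -
  have "card (uminus ` L) = card L"
    by (simp add: card_image)
  then have "card (L \<union> uminus ` L) = card (UNIV - {0 :: 'a})"
    using card disj by (simp add: card_Un_disjoint card_Diff_singleton)
  moreover have "L \<union> uminus ` L \<subseteq> UNIV - {0}"
    using \<open>0 \<notin> L\<close> by auto
  ultimately have "L \<union> uminus ` L = UNIV - {0}"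
    by (intro card_subset_eq) auto
  with card show ?thesis by (simp add: half_set_def)
qed

theorem theorem1:
  fixes m n q :: nat
  assumes "m \<ge> 3" and "n \<ge> 3"
    and "odd m" and "odd n"
    and "coprime m n"
    and "q = 2 * m * n + 1"
    and "primepow q"
    and "CARD('a :: {field, finite}) = q"
  shows "\<exists>A :: 'a mat. heffter_array m n A \<and> globally_simple A"
proof -
  have m: "m > 1" and n: "n > 1"
    using assms by simp_all
  obtain g :: 'a where g: "\<And>k. g ^ k = 1 \<longleftrightarrow> 2 * m * n dvd k"
    using finite_field_primitive_element[where ?'a = 'a] assms by auto
  \<comment> \<open>\<open>g ^ (m * n)\<close> is a square root of 1 other than 1, so it must be
    -1.\<close>
  have neg_one: "(-1 :: 'a) \<noteq> 1"
  proof -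
    have "(g ^ (m * n))\<^sup>2 = 1"
      by (simp add: g mult_ac flip: power_mult)
    moreover have "g ^ (m * n) \<noteq> 1"
      using m n by (auto simp: g dest: dvd_imp_le)
    ultimately show ?thesis
      by (auto simp: power2_eq_1_iff)
  qed
  define x where "x = g ^ (2 * n)"
  define y where "y = g ^ (2 * m)"
  have ord_x: "x ^ k = 1 \<longleftrightarrow> m dvd k" for k
    using n by (simp add: x_def g mult_ac flip: power_mult)
  have ord_y: "y ^ k = 1 \<longleftrightarrow> n dvd k" for k
    using m by (simp add: y_def g mult_ac flip: power_mult)
  have x0: "x \<noteq> 0" and y0: "y \<noteq> 0"
    using ord_x[of m] ord_y[of n] m n by (auto simp: power_0_left)
  define A where "A = mat m n (\<lambda>(i, j). x ^ i * y ^ j)"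
  have A: "A \<in> carrier_mat m n" by (simp add: A_def)
  have elems: "elements_mat A = (\<lambda>(i, j). x ^ i * y ^ j) ` ({..<m} \<times> {..<n})"
    by (force simp: A_def intro: elements_matI[OF A] dest: elements_matD)
  have root: "z ^ (m * n) = 1" if "z \<in> elements_mat A" for z
  proof -
    have "x ^ (i * (m * n)) = 1" "y ^ (j * (m * n)) = 1" for i j
      by (simp_all add: ord_x ord_y)
    then show ?thesis
      using that unfolding elems by (auto simp: power_mult_distrib simp flip: power_mult)
  qed
  have "half_set (elements_mat A)"
  proof (rule half_setI)
    have "card (elements_mat A) = m * n"
      unfolding elems using m n assms(5)
      by (subst card_image) (auto intro!: inj_on_mult_powers_of_coprime_order ord_x ord_y)
    then show "CARD('a) = 2 * card (elements_mat A) + 1"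
      using assms by simp
    show "0 \<notin> elements_mat A"
      using x0 y0 by (auto simp: elems)
    \<comment> \<open>As \<open>m * n\<close> is odd, the power of \<open>- z\<close> with this
      exponent is -1, whereas every entry satisfies \<open>root\<close>.\<close>
    have "- z \<notin> elements_mat A" if "z \<in> elements_mat A" for z
      using root[OF that] root[of "- z"] neg_one \<open>odd m\<close> \<open>odd n\<close> by auto
    then show "elements_mat A \<inter> uminus ` elements_mat A = {}"
      by blast
  qed
  moreover have "(\<Sum>j<n. A $$ (i, j)) = 0" if "i < m" for i
    using sum_geometric_of_order_eq_0[OF ord_y n, of "x ^ i"] that by (simp add: A_def)
  moreover have "(\<Sum>i<m. A $$ (i, j)) = 0" if "j < n" for j
    using sum_geometric_of_order_eq_0[OF ord_x m, of "y ^ j"] that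
    by (simp add: A_def mult.commute)
  ultimately have "heffter_array m n A"
    using A by (simp add: heffter_array_def)
  \<comment> \<open>For \<open>j\<close> in \<open>{1..n}\<close> only columns \<open>k < n\<close>
    are summed, so each entry may be replaced by its formula; \<open>x ^ i\<close> is then the
    constant factor.\<close>
  moreover have "inj_on (\<lambda>j. \<Sum>k<j. A $$ (i, k)) {1..n}" if "i < m" for i
    using inj_on_partial_geometric_sum_of_order[OF ord_y n, of "x ^ i"] x0 that
    by (subst inj_on_cong[where g = "\<lambda>j. \<Sum>k<j. x ^ i * y ^ k"])
       (auto simp: A_def intro!: sum.cong)
  moreover have "inj_on (\<lambda>i. \<Sum>k<i. A $$ (k, j)) {1..m}" if "j < n" for j
    using inj_on_partial_geometric_sum_of_order[OF ord_x m, of "y ^ j"] y0 that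
    by (subst inj_on_cong[where g = "\<lambda>i. \<Sum>k<i. y ^ j * x ^ k"])
       (auto simp: A_def mult.commute intro!: sum.cong)
  ultimately show ?thesis
    using A by (auto simp: globally_simple_def)
qed

end
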